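(* Let $p\ge 1$ and $N\ge 1$ be integers, let $\boldsymbol{\Sigma}\in\mathbb{R}^{p\times p}$ be a (symmetric) positive definite matrix, and let $\boldsymbol{Y}_1,\dots,\boldsymbol{Y}_N$ be independent and identically distributed random vectors in $\mathbb{R}^p$ with $\boldsymbol{Y}_i\sim\mathcal{SL}_p(\boldsymbol{\Sigma})$. Then a maximum likelihood estimator of the parameter $\boldsymbol{\Sigma}$ based on $\boldsymbol{Y}_1,\dots,\boldsymbol{Y}_N$ exists almost surely if and only if $N\ge p$.
   Context: For $\lambda\in\mathbb{R}$ and $x>0$, the modified Bessel function of the third kind is $$K_\lambda(x)=\frac12\left(\frac{x}{2}\right)^{\lambda}\int_0^\infty t^{-\lambda-1}\exp\left(-t-\frac{x^2}{4t}\right)dt .$$ For a symmetric positive definite matrix $\boldsymbol{\Sigma}\in\mathbb{R}^{p\times p}$, the multivariate symmetric Laplace distribution $\mathcal{SL}_p(\boldsymbol{\Sigma})$ is the distribution on $\mathbb{R}^p$ with Lebesgue density $$f(\boldsymbol{y};\boldsymbol{\Sigma})=\frac{2}{(2\pi)^{p/2}|\boldsymbol{\Sigma}|^{1/2}}\left(\frac{\boldsymbol{y}^\top\boldsymbol{\Sigma}^{-1}\boldsymbol{y}}{2}\right)^{\nu/2}K_\nu\left(\sqrt{2\boldsymbol{y}^\top\boldsymbol{\Sigma}^{-1}\boldsymbol{y}}\right),\qquad \nu=\frac{2-p}{2},$$ where $|\cdot|$ denotes the determinant. The likelihood function of the sample is $L(\boldsymbol{S})=\prod_{i=1}^N f(\boldsymbol{Y}_i;\boldsymbol{S})$,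 where $\boldsymbol{S}$ ranges over the symmetric positive definite $p\times p$ matrices; a maximum likelihood estimator is a symmetric positive definite matrix $\hat{\boldsymbol{\Sigma}}$ that maximizes $L$ over this set. *)

theory Defs
  imports "HOL-Probability.Probability"
begin

definition spd_matrix :: "real ^ 'p ^ 'p \<Rightarrow> bool" where
  "spd_matrix S \<longleftrightarrow> transpose S = S \<and> (\<forall>x. x \<noteq> 0 \<longrightarrow> 0 < x \<bullet> (S *v x))"

(* Meaningful for x > 0 only; since 0 powr a = 0, the value at x = 0 is 0. *)
definition bessel_K :: "real \<Rightarrow> real \<Rightarrow> real" where
  "bessel_K l x =
     1 / 2 * (x / 2) powr l *
     (LBINT t:{0<..}. t powr (- l - 1) * exp (- t - x\<^sup>2 / (4 * t)))"

(* At y = 0, where the formula has no meaning, the value is 0. This concerns a Lebesgue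
   null set only, so neither the distribution nor almost sure statements depend on it. *)
definition SL_density :: "real ^ 'p ^ 'p \<Rightarrow> real ^ 'p \<Rightarrow> real" where
  "SL_density S y =
     (let p = real CARD('p);
          \<nu> = (2 - p) / 2;
          q = y \<bullet> (matrix_inv S *v y)
      in 2 / ((2 * pi) powr (p / 2) * sqrt (det S)) *
         (q / 2) powr (\<nu> / 2) * bessel_K \<nu> (sqrt (2 * q)))"

definition SL_likelihood :: "nat \<Rightarrow> (nat \<Rightarrow> real ^ 'p) \<Rightarrow> real ^ 'p ^ 'p \<Rightarrow> real" where
  "SL_likelihood N y S = (\<Prod>i=1..N. SL_density S (y i))"

definition is_SL_mle :: "nat \<Rightarrow> (nat \<Rightarrow> real ^ 'p) \<Rightarrow> real ^ 'p ^ 'p \<Rightarrow> bool" where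
  "is_SL_mle N y S \<longleftrightarrow>
     spd_matrix S \<and> (\<forall>T. spd_matrix T \<longrightarrow> SL_likelihood N y T \<le> SL_likelihood N y S)"

end

theory Submission
  imports Defs
begin

text \<open>
  In terms of \<open>P = S\<^sup>-\<^sup>1\<close> and \<open>q\<^sub>i = Y\<^sub>i \<bullet> P Y\<^sub>i\<close> the likelihood is \<open>\<Prod>\<^sub>i sqrt (det P) * R(q\<^sub>i)\<close>, where
  \<open>q powr (p / 2) * R(q)\<close> is a bounded function that tends to \<open>0\<close> for \<open>q \<rightarrow> 0\<close> and \<open>q \<rightarrow> \<infinity>\<close>.

  If \<open>N < p\<close>, some \<open>v \<noteq> 0\<close> is orthogonal to all \<open>Y\<^sub>i\<close>. Stretching \<open>P\<close> in the direction of \<open>v\<close> keeps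
  every \<open>q\<^sub>i\<close> but enlarges \<open>det P\<close>, so there is no maximum.

  If \<open>N \<ge> p\<close>, almost surely any \<open>p\<close> of the \<open>Y\<^sub>i\<close> form a basis, and Hadamard's inequality bounds \<open>det P\<close>
  by a constant times the product of the corresponding \<open>q\<^sub>i\<close>. Multiplying over the \<open>N\<close> cyclic windows of
  length \<open>p\<close> gives \<open>det P ^ N \<le> c * (\<Prod>\<^sub>i q\<^sub>i) ^ p\<close>, hence the likelihood is at most a constant times
  \<open>\<Prod>\<^sub>i q\<^sub>i powr (p / 2) * R(q\<^sub>i)\<close>. On a superlevel set all \<open>q\<^sub>i\<close> therefore stay in a compact subinterval of
  \<open>(0, \<infinity>)\<close>, which confines \<open>P\<close> to a compact set of positive semidefinite matrices.
\<close>

section \<open>Positive semidefinite matrices\<close>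

text \<open>Unlike \<open>spd_matrix\<close> this condition is closed, so a maximiser can be sought
  in a compact set of such matrices and shown to be nonsingular afterwards.\<close>

definition psd_matrix :: "real ^ 'n ^ 'n \<Rightarrow> bool" where
  "psd_matrix S \<longleftrightarrow> transpose S = S \<and> (\<forall>x. 0 \<le> x \<bullet> (S *v x))"

lemma inner_matrix_vector_transpose:
  fixes A :: "real ^ 'n ^ 'm"
  shows "x \<bullet> (A *v y) = (transpose A *v x) \<bullet> y"
  by (simp add: dot_lmul_matrix)

lemma inner_symmetric_matrix:
  fixes S :: "real ^ 'n ^ 'n"
  assumes "transpose S = S"
  shows "x \<bullet> (S *v y) = y \<bullet> (S *v x)"
  by (metis assms inner_commute inner_matrix_vector_transpose)

lemma spd_imp_psd: "spd_matrix S \<Longrightarrow> psd_matrix S"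
  unfolding spd_matrix_def psd_matrix_def by (metis inner_zero_left order.order_iff_strict)

text \<open>The form at \<open>x + t *\<^sub>R y\<close> is a nonnegative polynomial in
  \<open>t\<close>. As \<open>S\<close> may be singular, its leading coefficient \<open>c\<close>
  can vanish, which needs a case of its own.\<close>

lemma psd_cauchy_schwarz:
  fixes S :: "real ^ 'n ^ 'n"
  assumes "psd_matrix S"
  shows "(x \<bullet> (S *v y))\<^sup>2 \<le> (x \<bullet> (S *v x)) * (y \<bullet> (S *v y))"
proof -
  define a b c where "a = x \<bullet> (S *v x)" and "b = x \<bullet> (S *v y)" and "c = y \<bullet> (S *v y)"
  have sym: "y \<bullet> (S *v x) = b"
    using assms unfolding psd_matrix_def b_def by (metis inner_symmetric_matrix)
  have quad: "0 \<le> a + 2 * t * b + t\<^sup>2 * c" for t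
  proof -
    have "0 \<le> (x + t *\<^sub>R y) \<bullet> (S *v (x + t *\<^sub>R y))"
      using assms by (simp add: psd_matrix_def)
    also have "\<dots> = a + 2 * t * b + t\<^sup>2 * c"
      using sym by (simp add: a_def[symmetric] b_def[symmetric] c_def[symmetric]
          matrix_vector_right_distrib matrix_vector_mult_scaleR
          inner_add_left inner_add_right power2_eq_square algebra_simps)
    finally show ?thesis .
  qed
  have "0 \<le> c" using assms by (simp add: psd_matrix_def c_def)
  then consider "c = 0" | "0 < c" by linarith
  then have "b\<^sup>2 \<le> a * c"
  proof cases
    case 1
    have "b = 0"
    proof (rule ccontr)
      assume "b \<noteq> 0"
      then have "a + 2 * (- (a + 1) / (2 * b)) * b = - 1" by (simp add: field_simps)
      then show False using quad[of "- (a + 1) / (2 * b)"] 1 by simp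
    qed
    then show ?thesis using 1 by simp
  next
    case 2
    \<comment> \<open>\<open>t = - b / c\<close> is the minimiser of the polynomial.\<close>
    have "0 \<le> a - b\<^sup>2 / c"
      using quad[of "- b / c"] 2 by (simp add: power2_eq_square field_simps)
    then show ?thesis using 2 by (simp add: field_simps)
  qed
  then show ?thesis by (simp add: a_def b_def c_def)
qed

lemma spd_det_nz:
  fixes S :: "real ^ 'n ^ 'n"
  assumes "spd_matrix S"
  shows "det S \<noteq> 0"
proof -
  have "inj ((*v) S)"
  proof (rule injI)
    fix x y assume "S *v x = S *v y"
    then have "(x - y) \<bullet> (S *v (x - y)) = 0"
      by (simp add: matrix_vector_mult_diff_distrib)
    then have "\<not> 0 < (x - y) \<bullet> (S *v (x - y))"
      by linarith
    then show "x = y" using assms unfolding spd_matrix_def by (metis eq_iff_diff_eq_0)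
  qed
  then show ?thesis using det_nz_iff_inj[of "(*v) S"] by simp
qed

lemma continuous_on_det [continuous_intros]:
  fixes f :: "'a::topological_space \<Rightarrow> real ^ 'n ^ 'n"
  assumes "continuous_on A f"
  shows "continuous_on A (\<lambda>x. det (f x))"
  unfolding det_def by (intro continuous_intros assms)

text \<open>The segment from the identity to \<open>S\<close> consists of positive definite matrices, so the
  determinant has no zero on it.\<close>

lemma spd_det_pos:
  fixes S :: "real ^ 'n ^ 'n"
  assumes "spd_matrix S"
  shows "0 < det S"
proof (rule ccontr)
  assume "\<not> 0 < det S"
  define \<gamma> where "\<gamma> t = (1 - t) *\<^sub>R mat 1 + t *\<^sub>R S" for t :: real
  have "continuous_on {0..1} (\<lambda>t. det (\<gamma> t))"
    unfolding \<gamma>_def by (intro continuous_intros)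
  then obtain t where t: "0 \<le> t" "t \<le> 1" "det (\<gamma> t) = 0"
    using IVT2'[of "\<lambda>t. det (\<gamma> t)" 1 0 0] \<open>\<not> 0 < det S\<close> by (auto simp: \<gamma>_def)
  have "spd_matrix (\<gamma> t)"
    unfolding spd_matrix_def
  proof (intro conjI allI impI)
    have "transpose S = S" using assms by (simp add: spd_matrix_def)
    then show "transpose (\<gamma> t) = \<gamma> t"
      unfolding \<gamma>_def by (simp add: transpose_def mat_def vec_eq_iff)
    fix x :: "real ^ 'n" assume "x \<noteq> 0"
    have "x \<bullet> (\<gamma> t *v x) = (1 - t) * (x \<bullet> x) + t * (x \<bullet> (S *v x))"
      by (simp add: \<gamma>_def matrix_vector_mult_add_rdistrib scaleR_matrix_vector_assoc[symmetric]
          inner_add_right)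
    moreover have "0 < x \<bullet> x" "0 < x \<bullet> (S *v x)"
      using \<open>x \<noteq> 0\<close> assms by (auto simp: spd_matrix_def)
    ultimately show "0 < x \<bullet> (\<gamma> t *v x)"
      using t by (cases "t = 0") (auto intro!: add_nonneg_pos mult_nonneg_nonneg mult_pos_pos)
  qed
  then show False using spd_det_nz t by blast
qed

text \<open>By Cauchy-Schwarz, a vector on which the form vanishes lies in the kernel of
  \<open>S\<close>.\<close>

lemma psd_det_nz_imp_spd:
  fixes S :: "real ^ 'n ^ 'n"
  assumes "psd_matrix S" "det S \<noteq> 0"
  shows "spd_matrix S"
  unfolding spd_matrix_def
proof (intro conjI allI impI)
  show "transpose S = S" using assms by (simp add: psd_matrix_def)
  fix x :: "real ^ 'n" assume "x \<noteq> 0"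
  have "x \<bullet> (S *v x) \<noteq> 0"
  proof
    assume 0: "x \<bullet> (S *v x) = 0"
    have "((S *v x) \<bullet> (S *v x))\<^sup>2 \<le> 0"
      using psd_cauchy_schwarz[OF assms(1), of "S *v x" x] unfolding 0 mult_zero_right .
    then have "(S *v x) \<bullet> (S *v x) = 0" by (metis zero_eq_power2 zero_le_power2 order_antisym)
    then have "S *v x = S *v 0" by (simp only: inner_eq_zero_iff matrix_vector_mult_0_right)
    moreover have "inj ((*v) S)" using det_nz_iff_inj[of "(*v) S"] assms(2) by simp
    ultimately have "x = 0" by (rule injD[rotated])
    then show False using \<open>x \<noteq> 0\<close> by simp
  qed
  moreover have "0 \<le> x \<bullet> (S *v x)" using assms(1) by (simp add: psd_matrix_def)
  ultimately show "0 < x \<bullet> (S *v x)" by linarith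
qed

section \<open>Inverses and congruence transformations\<close>

lemma matrix_inv_unique:
  fixes A :: "real ^ 'n ^ 'n"
  assumes "A ** B = mat 1"
  shows "matrix_inv A = B"
proof -
  have "B ** A = mat 1" using assms by (simp add: matrix_left_right_inverse)
  then have "A ** matrix_inv A = mat 1"
    using someI[of "\<lambda>A'. A ** A' = mat 1 \<and> A' ** A = mat 1" B] assms
    unfolding matrix_inv_def by blast
  then have "B ** A ** matrix_inv A = B" by (simp only: matrix_mul_assoc[symmetric] matrix_mul_rid)
  then show ?thesis using \<open>B ** A = mat 1\<close> by (simp only: matrix_mul_lid)
qed

lemma spd_matrix_inv:
  fixes S :: "real ^ 'n ^ 'n"
  assumes "spd_matrix S"
  shows "S ** matrix_inv S = mat 1" "spd_matrix (matrix_inv S)"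
    "matrix_inv (matrix_inv S) = S" "det (matrix_inv S) = 1 / det S"
proof -
  obtain B where B: "S ** B = mat 1" "B ** S = mat 1"
    using spd_det_nz[OF assms] by (metis invertible_def invertible_det_nz)
  have inv: "matrix_inv S = B" using B(1) by (rule matrix_inv_unique)
  then show "S ** matrix_inv S = mat 1" using B by simp
  show "matrix_inv (matrix_inv S) = S" using inv B(2) matrix_inv_unique by blast
  have "det S * det B = 1" by (simp only: det_mul[symmetric] B(1) det_I)
  then show "det (matrix_inv S) = 1 / det S"
    using spd_det_nz[OF assms] inv by (simp add: field_simps)
  have sym: "transpose S = S" using assms by (simp add: spd_matrix_def)
  have "transpose (B ** S) = mat 1" by (simp only: B(2) transpose_mat)
  then have "S ** transpose B = mat 1" by (simp only: matrix_transpose_mul sym)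
  then have "transpose B = B" using inv matrix_inv_unique[of S "transpose B"] by simp
  moreover have "0 < x \<bullet> (B *v x)" if "x \<noteq> 0" for x
  proof -
    have x: "S *v (B *v x) = x" using B by (simp add: matrix_vector_mul_assoc)
    then have "B *v x \<noteq> 0" using that by auto
    then have "0 < (B *v x) \<bullet> (S *v (B *v x))" using assms by (simp add: spd_matrix_def)
    then show ?thesis by (simp add: x inner_commute)
  qed
  ultimately show "spd_matrix (matrix_inv S)" by (simp add: inv spd_matrix_def)
qed

lemma inner_congruence:
  fixes S B :: "real ^ 'n ^ 'n"
  shows "x \<bullet> ((B ** S ** transpose B) *v y) = (transpose B *v x) \<bullet> (S *v (transpose B *v y))"
  unfolding matrix_vector_mul_assoc[symmetric] by (rule inner_matrix_vector_transpose)

lemma psd_congruence: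
  fixes S B :: "real ^ 'n ^ 'n"
  assumes "psd_matrix S"
  shows "psd_matrix (B ** S ** transpose B)"
  using assms unfolding psd_matrix_def inner_congruence
  by (simp add: matrix_transpose_mul matrix_mul_assoc)

text \<open>The congruent matrix is the Gram matrix of the rows of \<open>B\<close> for the form
  \<open>S\<close>; with sample points as rows, its diagonal consists of the values
  \<open>q\<^sub>i\<close>.\<close>

lemma nth_congruence:
  fixes S B :: "real ^ 'n ^ 'n"
  shows "(B ** S ** transpose B) $ i $ j = (B $ i) \<bullet> (S *v (B $ j))"
proof -
  have "axis k 1 \<bullet> (A *v axis l 1) = A $ k $ l" for A :: "real ^ 'n ^ 'n" and k l
    by (simp add: inner_axis' matrix_vector_mult_basis column_def)
  then have "(B ** S ** transpose B) $ i $ j = axis i 1 \<bullet> ((B ** S ** transpose B) *v axis j 1)"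
    by metis
  also have "\<dots> = (B $ i) \<bullet> (S *v (B $ j))"
    unfolding inner_congruence by (simp add: matrix_vector_mult_basis column_def transpose_def
        del: transpose_matrix_vector)
  finally show ?thesis .
qed

text \<open>Cauchy-Schwarz for standard basis vectors.\<close>

lemma psd_nth_le:
  fixes S :: "real ^ 'n ^ 'n"
  assumes "psd_matrix S"
  shows "\<bar>S $ i $ j\<bar> \<le> sqrt (S $ i $ i) * sqrt (S $ j $ j)" "0 \<le> S $ i $ i"
proof -
  have nth: "S $ i $ j = axis i 1 \<bullet> (S *v axis j 1)" for i j
    by (simp add: inner_axis' matrix_vector_mult_basis column_def)
  show "0 \<le> S $ i $ i" using assms unfolding nth by (simp add: psd_matrix_def)
  show "\<bar>S $ i $ j\<bar> \<le> sqrt (S $ i $ i) * sqrt (S $ j $ j)"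
    using psd_cauchy_schwarz[OF assms, of "axis i 1" "axis j 1"] unfolding nth[symmetric]
    by (simp add: real_le_rsqrt real_sqrt_mult[symmetric])
qed

text \<open>A weak form of Hadamard's inequality: every term of the Leibniz expansion is bounded by
  the product of the diagonal.\<close>

lemma psd_det_le:
  fixes S :: "real ^ 'n ^ 'n"
  assumes "psd_matrix S"
  shows "det S \<le> fact CARD('n) * (\<Prod>i\<in>UNIV. S $ i $ i)"
proof -
  have "det S \<le> (\<Sum>\<pi> | \<pi> permutes (UNIV :: 'n set). (\<Prod>i\<in>UNIV. S $ i $ i))"
    unfolding det_def
  proof (rule sum_mono)
    fix \<pi> :: "'n \<Rightarrow> 'n" assume "\<pi> \<in> {\<pi>. \<pi> permutes UNIV}"
    then have \<pi>: "\<pi> permutes UNIV" by simp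
    have "of_int (sign \<pi>) * (\<Prod>i\<in>UNIV. S $ i $ \<pi> i) \<le> (\<Prod>i\<in>UNIV. \<bar>S $ i $ \<pi> i\<bar>)"
      by (cases rule: sign_cases[of \<pi>]) (auto simp: abs_prod[symmetric] abs_le_iff)
    also have "\<dots> \<le> (\<Prod>i\<in>UNIV. sqrt (S $ i $ i) * sqrt (S $ \<pi> i $ \<pi> i))"
      using psd_nth_le[OF assms] by (intro prod_mono) auto
    \<comment> \<open>A permutation only reorders the second factors, so both products of square
      roots coincide.\<close>
    also have "\<dots> = (\<Prod>i\<in>UNIV. sqrt (S $ i $ i)) * (\<Prod>i\<in>UNIV. sqrt (S $ i $ i))"
      using prod.permute[OF \<pi>, of "\<lambda>i. sqrt (S $ i $ i)"] by (simp add: prod.distrib o_def)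
    also have "\<dots> = (\<Prod>i\<in>UNIV. S $ i $ i)"
      using psd_nth_le(2)[OF assms] by (simp add: prod.distrib[symmetric])
    finally show "of_int (sign \<pi>) * (\<Prod>i\<in>UNIV. S $ i $ \<pi> i) \<le> (\<Prod>i\<in>UNIV. S $ i $ i)" .
  qed
  then show ?thesis by (simp add: card_permutations)
qed

text \<open>A diagonal matrix that doubles one coordinate is conjugated by an orthogonal matrix
  taking the corresponding unit vector to the direction of \<open>v\<close>.\<close>

lemma exists_matrix_stretching_orthogonal:
  fixes v :: "real ^ 'n"
  assumes "v \<noteq> 0"
  obtains B :: "real ^ 'n ^ 'n" where "det B = 2" "\<And>x. v \<bullet> x = 0 \<Longrightarrow> B *v x = x"
proof -
  define k :: 'n where "k = undefined"
  define u where "u = v /\<^sub>R norm v"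
  have "norm u = 1" using assms by (simp add: u_def)
  then obtain R :: "real ^ 'n ^ 'n" where R: "orthogonal_matrix R" "R *v axis k 1 = u"
    using orthogonal_matrix_exists_basis by metis
  define D :: "real ^ 'n ^ 'n" where "D = (\<chi> i j. if i = j then if i = k then 2 else 1 else 0)"
  have "det D = (\<Prod>i\<in>UNIV. if i = k then 2 else 1)"
    by (subst det_diagonal) (auto simp: D_def)
  then have "det D = 2" by simp
  have RR: "R ** transpose R = mat 1" using R by (simp add: orthogonal_matrix_def)
  show ?thesis
  proof
    have "det (R ** D ** transpose R) = det D * det (R ** transpose R)"
      by (simp add: det_mul)
    then show "det (R ** D ** transpose R) = 2" using RR \<open>det D = 2\<close> by simp
    fix x assume "v \<bullet> x = 0"
    define y where "y = transpose R *v x"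
    have "y $ k = axis k 1 \<bullet> y" by (simp add: inner_axis')
    also have "\<dots> = u \<bullet> x"
      unfolding y_def inner_matrix_vector_transpose transpose_transpose R(2) ..
    also have "\<dots> = 0" using \<open>v \<bullet> x = 0\<close> by (simp add: u_def)
    finally have "D *v y = y"
      by (auto simp: vec_eq_iff matrix_vector_mult_def D_def if_distrib[of "\<lambda>a. a * _"]
          cong: if_cong)
    then show "(R ** D ** transpose R) *v x = x"
      using RR unfolding y_def matrix_vector_mul_assoc[symmetric]
      by (simp add: matrix_vector_mul_assoc del: transpose_matrix_vector)
  qed
qed

section \<open>The radial part of the density\<close>

text \<open>The integral is \<open>Gamma (b + 1)\<close>, finite because
  \<open>b + 1 > 0\<close>.\<close>

lemma set_integrable_Gamma:
  fixes b :: real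
  assumes "- 1 < b"
  shows "set_integrable lborel {0<..} (\<lambda>t. t powr b * exp (- t))"
proof -
  have "integrable lborel (\<lambda>t. indicator {0..} t * t powr b / exp t)"
    using Gamma_conv_nn_integral_real[of "b + 1"] assms
    by (intro integrableI_nonneg) (auto simp: less_top[symmetric] split: split_indicator)
  then show ?thesis
    unfolding set_integrable_def
    by (rule Bochner_Integration.integrable_bound)
       (auto simp: exp_minus field_simps split: split_indicator)
qed

text \<open>The quadratic Taylor bound gives \<open>1 + x^2 <= 2 * exp x\<close>, hence the
  restriction to \<open>s <= 2\<close>.\<close>

lemma exp_minus_le_powr:
  fixes x s :: real
  assumes "0 < x" "0 \<le> s" "s \<le> 2"
  shows "exp (- x) \<le> 2 * x powr (- s)"
proof -
  have "x powr s \<le> 1 + x\<^sup>2"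
  proof (cases "x \<le> 1")
    case True
    then have "x powr s \<le> 1" using assms by (simp add: powr_le1)
    then show ?thesis by (simp add: add_increasing2)
  next
    case False
    then have "x powr s \<le> x powr 2" using assms by (intro powr_mono) auto
    then show ?thesis using assms by simp
  qed
  also have "\<dots> \<le> 2 * exp x"
    using exp_lower_Taylor_quadratic[of x] assms by simp
  finally show ?thesis using assms by (simp add: powr_minus exp_minus field_simps)
qed

text \<open>The Bessel integrand at \<open>x = sqrt (2 * q)\<close>, where
  \<open>x^2 / (4 * t)\<close> becomes \<open>q / (2 * t)\<close>; the exponent \<open>a\<close>
  stands for \<open>- \<nu> - 1\<close>.\<close>

definition SL_integrand :: "real \<Rightarrow> real \<Rightarrow> real \<Rightarrow> real" where
  "SL_integrand a q t = t powr a * exp (- t - q / (2 * t))"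

definition SL_integral :: "real \<Rightarrow> real \<Rightarrow> real" where
  "SL_integral a q = (LBINT t:{0<..}. SL_integrand a q t)"

lemma SL_integrand_measurable [measurable]: "SL_integrand a q \<in> borel_measurable borel"
  unfolding SL_integrand_def by measurable

lemma SL_integrand_nonneg: "0 \<le> SL_integrand a q t"
  by (simp add: SL_integrand_def)

text \<open>Estimating only the factor \<open>exp (- q / (2 * t))\<close> yields decay in
  \<open>q\<close> and \<open>s\<close> extra powers of \<open>t\<close>, which tame the singularity
  at \<open>t = 0\<close>.\<close>

lemma SL_integrand_le:
  assumes "0 < q" "0 < t" "0 \<le> s" "s \<le> 2"
  shows "SL_integrand a q t \<le> (2 * (q / 2) powr (- s)) * (t powr (a + s) * exp (- t))"
proof -
  have "exp (- (q / (2 * t))) \<le> 2 * (q / 2 / t) powr (- s)"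
    using exp_minus_le_powr[of "q / (2 * t)" s] assms by simp
  also have "\<dots> = 2 * (q / 2) powr (- s) * t powr s"
    using assms by (simp add: powr_divide powr_minus powr_mult field_simps)
  finally have "t powr a * exp (- t) * exp (- (q / (2 * t)))
      \<le> t powr a * exp (- t) * (2 * (q / 2) powr (- s) * t powr s)"
    by (intro mult_left_mono) auto
  then show ?thesis
    by (simp add: SL_integrand_def powr_add exp_diff exp_minus field_simps)
qed

text \<open>The bound with \<open>s = 2\<close> needs \<open>a + 2 > -1\<close>, whence the limit
  \<open>-3\<close>; the exponent \<open>p / 2 - 2\<close> of the density respects it.\<close>

lemma set_integrable_SL_integrand:
  assumes "0 < q" "- 3 < a"
  shows "set_integrable lborel {0<..} (SL_integrand a q)"
proof (rule set_integrable_bound)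
  show "set_integrable lborel {0<..} (\<lambda>t. (2 * (q / 2) powr (- 2)) * (t powr (a + 2) * exp (- t)))"
    using assms by (intro set_integrable_mult_right set_integrable_Gamma) auto
  show "set_borel_measurable lborel {0<..} (SL_integrand a q)"
    unfolding set_borel_measurable_def by measurable
  show "AE t in lborel. t \<in> {0<..} \<longrightarrow> norm (SL_integrand a q t)
      \<le> norm ((2 * (q / 2) powr (- 2)) * (t powr (a + 2) * exp (- t)))"
    using SL_integrand_le[OF assms(1), of _ 2] SL_integrand_nonneg
    by (intro AE_I2) (auto simp: abs_mult)
qed

lemma SL_integral_le:
  assumes "0 < q" "- 3 < a" "- 1 < a + s" "0 \<le> s" "s \<le> 2"
  shows "SL_integral a q \<le> 2 * (q / 2) powr (- s) * (LBINT t:{0<..}. t powr (a + s) * exp (- t))"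
proof -
  have "SL_integral a q \<le> (LBINT t:{0<..}. (2 * (q / 2) powr (- s)) * (t powr (a + s) * exp (- t)))"
    unfolding SL_integral_def using assms
    by (intro set_integral_mono set_integrable_SL_integrand set_integrable_mult_right
        set_integrable_Gamma SL_integrand_le) auto
  then show ?thesis by (simp only: set_integral_mult_right)
qed

text \<open>A zero integral would make the nonnegative integrand vanish almost everywhere, but it is
  positive on \<open>{0<..<1}\<close>, which is not a null set.\<close>

lemma SL_integral_pos:
  assumes "0 < q" "- 3 < a"
  shows "0 < SL_integral a q"
proof -
  have int: "set_integrable lborel {0<..} (SL_integrand a q)"
    using assms by (rule set_integrable_SL_integrand)
  have "SL_integral a q \<noteq> 0"
  proof
    assume "SL_integral a q = 0"
    then have "AE t in lborel. indicator {0<..} t *\<^sub>R SL_integrand a q t = 0"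
      unfolding SL_integral_def set_lebesgue_integral_def
      using int integral_nonneg_eq_0_iff_AE[of lborel "\<lambda>t. indicator {0<..} t *\<^sub>R SL_integrand a q t"]
      by (auto simp: set_integrable_def SL_integrand_nonneg)
    then have "AE t in lborel. t \<notin> {0<..<1::real}"
      by eventually_elim (auto simp: SL_integrand_def)
    then have "{0<..<1::real} \<in> null_sets lborel"
      by (subst (asm) AE_iff_null_sets[symmetric]) auto
    then show False by (simp add: null_sets_def)
  qed
  moreover have "0 \<le> SL_integral a q"
    unfolding SL_integral_def set_lebesgue_integral_def
    by (intro Bochner_Integration.integral_nonneg) (auto simp: SL_integrand_nonneg)
  ultimately show ?thesis by linarith
qed

text \<open>Dominated convergence: the integrand decreases in \<open>q\<close>, so its value at the
  left end \<open>c\<close> is a dominating function.\<close>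

lemma continuous_on_SL_integral:
  assumes "0 < c" "- 3 < a"
  shows "continuous_on {c..} (SL_integral a)"
proof (rule continuous_on_sequentiallyI)
  fix u q assume u: "\<forall>n. u n \<in> {c..}" and "q \<in> {c..}" and lim: "u \<longlonglongrightarrow> q"
  show "(\<lambda>n. SL_integral a (u n)) \<longlonglongrightarrow> SL_integral a q"
    unfolding SL_integral_def set_lebesgue_integral_def
  proof (rule integral_dominated_convergence)
    show "integrable lborel (\<lambda>t. indicator {0<..} t *\<^sub>R SL_integrand a c t)"
      using set_integrable_SL_integrand[OF assms] by (simp add: set_integrable_def)
    show "AE t in lborel. (\<lambda>n. indicator {0<..} t *\<^sub>R SL_integrand a (u n) t)
        \<longlonglongrightarrow> indicator {0<..} t *\<^sub>R SL_integrand a q t"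
      unfolding SL_integrand_def divide_inverse by (intro AE_I2 tendsto_intros lim)
    show "AE t in lborel. norm (indicator {0<..} t *\<^sub>R SL_integrand a (u n) t)
        \<le> indicator {0<..} t *\<^sub>R SL_integrand a c t" for n
      using u by (intro AE_I2)
        (auto simp: SL_integrand_def divide_right_mono split: split_indicator)
  qed measurable
qed

text \<open>The factor \<open>(q / 2) powr (1 - p / 2)\<close> combines the power of \<open>q\<close> in the density with the one in
  the Bessel function.\<close>

definition SL_radial :: "real \<Rightarrow> real \<Rightarrow> real" where
  "SL_radial p q = (2 * pi) powr (- (p / 2)) * (q / 2) powr (1 - p / 2) * SL_integral (p / 2 - 2) q"

text \<open>For \<open>x = sqrt (2 * q)\<close> the Bessel prefactor
  \<open>(x / 2) powr \<nu>\<close> equals \<open>(q / 2) powr (\<nu> / 2)\<close>, the same power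
  that stands in the density.\<close>

lemma SL_density_eq:
  fixes S :: "real ^ 'p ^ 'p"
  assumes "0 < y \<bullet> (matrix_inv S *v y)"
  shows "SL_density S y = SL_radial (real CARD('p)) (y \<bullet> (matrix_inv S *v y)) / sqrt (det S)"
proof -
  define p where "p = real CARD('p)"
  define q where "q = y \<bullet> (matrix_inv S *v y)"
  define \<nu> where "\<nu> = (2 - p) / 2"
  have q: "0 < q" using assms by (simp add: q_def)
  have "sqrt (q / 2) = sqrt (2 * q) / 2"
    using q by (intro real_sqrt_unique) (simp_all add: power_divide)
  then have "sqrt (2 * q) / 2 = (q / 2) powr (1 / 2)"
    using q by (simp add: powr_half_sqrt)
  then have "(sqrt (2 * q) / 2) powr \<nu> = (q / 2) powr (\<nu> / 2)"
    by (simp add: powr_powr)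
  moreover have "SL_integrand (p / 2 - 2) q t
      = t powr (- \<nu> - 1) * exp (- t - (sqrt (2 * q))\<^sup>2 / (4 * t))" for t
  proof -
    have "- \<nu> - 1 = p / 2 - 2" by (simp add: \<nu>_def diff_divide_distrib)
    moreover have "(sqrt (2 * q))\<^sup>2 / (4 * t) = q / (2 * t)" using q by simp
    ultimately show ?thesis by (simp only: SL_integrand_def)
  qed
  ultimately have "bessel_K \<nu> (sqrt (2 * q)) = 1 / 2 * (q / 2) powr (\<nu> / 2) * SL_integral (p / 2 - 2) q"
    by (simp add: bessel_K_def SL_integral_def)
  then have "(q / 2) powr (\<nu> / 2) * bessel_K \<nu> (sqrt (2 * q))
      = 1 / 2 * ((q / 2) powr (\<nu> / 2) * (q / 2) powr (\<nu> / 2)) * SL_integral (p / 2 - 2) q"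
    by simp
  also have "(q / 2) powr (\<nu> / 2) * (q / 2) powr (\<nu> / 2) = (q / 2) powr (1 - p / 2)"
    unfolding powr_add[symmetric] by (simp add: \<nu>_def diff_divide_distrib)
  finally have "(q / 2) powr (\<nu> / 2) * bessel_K \<nu> (sqrt (2 * q))
      = 1 / 2 * (q / 2) powr (1 - p / 2) * SL_integral (p / 2 - 2) q" .
  moreover have "SL_density S y = 2 / ((2 * pi) powr (p / 2) * sqrt (det S))
      * ((q / 2) powr (\<nu> / 2) * bessel_K \<nu> (sqrt (2 * q)))"
    by (simp add: SL_density_def Let_def p_def q_def \<nu>_def)
  ultimately have "SL_density S y = 2 / ((2 * pi) powr (p / 2) * sqrt (det S))
      * (1 / 2 * (q / 2) powr (1 - p / 2) * SL_integral (p / 2 - 2) q)"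
    by (simp only:)
  then show ?thesis
    unfolding SL_radial_def p_def[symmetric] q_def[symmetric] powr_minus
    by (simp add: inverse_eq_divide)
qed

lemma SL_radial_pos: "0 < q \<Longrightarrow> 0 \<le> p \<Longrightarrow> 0 < SL_radial p q"
  by (simp add: SL_radial_def SL_integral_pos)

lemma continuous_on_SL_radial:
  assumes "0 < c" "0 \<le> p"
  shows "continuous_on {c..} (SL_radial p)"
  unfolding SL_radial_def using assms
  by (intro continuous_intros continuous_on_SL_integral) auto

text \<open>The powers of \<open>q\<close> in the weight and the prefactor multiply to
  \<open>q\<close>, and the integral is at most a constant times \<open>q powr (- s)\<close>. Taking
  \<open>s = 3 / 4\<close> and \<open>s = 5 / 4\<close>, on either side of 1, gives decay at 0 and
  at infinity.\<close>

lemma SL_radial_weighted_le: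
  assumes "1 \<le> p"
  obtains C where "0 \<le> C" "\<And>q. 0 < q \<Longrightarrow> sqrt q powr p * SL_radial p q \<le> C * q powr (1 / 4)"
    "\<And>q. 0 < q \<Longrightarrow> sqrt q powr p * SL_radial p q \<le> C * q powr (- (1 / 4))"
proof -
  define I where "I s = (LBINT t:{0<..}. t powr (p / 2 - 2 + s) * exp (- t))" for s :: real
  define D where "D s = (2 * pi) powr (- (p / 2)) * 2 powr (p / 2 - 1) * (2 * 2 powr s * I s)" for s :: real
  have I: "0 \<le> I s" for s
    unfolding I_def set_lebesgue_integral_def by (intro Bochner_Integration.integral_nonneg) auto
  then have D: "0 \<le> D s" for s by (simp add: D_def)
  \<comment> \<open>\<open>s >= 3 / 4\<close> ensures \<open>p / 2 - 2 + s > -1\<close> for all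
    \<open>p >= 1\<close>, so the Gamma integral \<open>I s\<close> converges.\<close>
  have le: "sqrt q powr p * SL_radial p q \<le> D s * q powr (1 - s)"
    if q: "0 < q" and s: "3 / 4 \<le> s" "s \<le> 2" for q s
  proof -
    have "sqrt q = q powr (1 / 2)" using q by (simp add: powr_half_sqrt)
    then have "sqrt q powr p = q powr (p / 2)" by (simp only: powr_powr) simp
    moreover have "(q / 2) powr (1 - p / 2) = q powr (1 - p / 2) * 2 powr (p / 2 - 1)"
      using q powr_minus_divide[of 2 "1 - p / 2"] by (simp add: powr_divide)
    ultimately have "sqrt q powr p * SL_radial p q
        = (2 * pi) powr (- (p / 2)) * 2 powr (p / 2 - 1) * (q powr (p / 2) * q powr (1 - p / 2))
          * SL_integral (p / 2 - 2) q"
      by (simp add: SL_radial_def)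
    also have "q powr (p / 2) * q powr (1 - p / 2) = q powr 1"
      unfolding powr_add[symmetric] by simp
    also have "(2 * pi) powr (- (p / 2)) * 2 powr (p / 2 - 1) * q powr 1 * SL_integral (p / 2 - 2) q
        \<le> (2 * pi) powr (- (p / 2)) * 2 powr (p / 2 - 1) * q powr 1 * (2 * (q / 2) powr (- s) * I s)"
      unfolding I_def using q s assms by (intro mult_left_mono SL_integral_le) auto
    also have "(q / 2) powr (- s) = q powr (- s) * 2 powr s"
      using q by (simp add: powr_divide powr_minus field_simps)
    also have "(2 * pi) powr (- (p / 2)) * 2 powr (p / 2 - 1) * q powr 1 * (2 * (q powr (- s) * 2 powr s) * I s)
        = D s * (q powr 1 * q powr (- s))"
      by (simp add: D_def)
    also have "q powr 1 * q powr (- s) = q powr (1 - s)"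
      unfolding powr_add[symmetric] by simp
    finally show ?thesis .
  qed
  show ?thesis
  proof
    show "0 \<le> D (3 / 4) + D (5 / 4)" using D by (simp add: add_nonneg_nonneg)
    fix q :: real assume "0 < q"
    have "D (3 / 4) * q powr (1 / 4) \<le> (D (3 / 4) + D (5 / 4)) * q powr (1 / 4)"
      "D (5 / 4) * q powr (- (1 / 4)) \<le> (D (3 / 4) + D (5 / 4)) * q powr (- (1 / 4))"
      using D by (auto intro!: mult_right_mono)
    then show "sqrt q powr p * SL_radial p q \<le> (D (3 / 4) + D (5 / 4)) * q powr (1 / 4)"
      "sqrt q powr p * SL_radial p q \<le> (D (3 / 4) + D (5 / 4)) * q powr (- (1 / 4))"
      using le[OF \<open>0 < q\<close>, of "3 / 4"] le[OF \<open>0 < q\<close>, of "5 / 4"] by auto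
  qed
qed

section \<open>Almost sure linear independence\<close>

lemma borel_measurable_det:
  fixes F :: "'a \<Rightarrow> real ^ 'n ^ 'n"
  assumes "\<And>i j. (\<lambda>x. F x $ i $ j) \<in> borel_measurable N"
  shows "(\<lambda>x. det (F x)) \<in> borel_measurable N"
  unfolding det_def
  by (intro borel_measurable_sum borel_measurable_times borel_measurable_prod borel_measurable_const assms)

text \<open>The determinant is linear in row \<open>k\<close>; the representing vector holds the
  cofactors of that row.\<close>

lemma det_row_eq_inner:
  fixes g :: "'n \<Rightarrow> real ^ 'n"
  shows "det (\<chi> j. if j = k then x else g j)
    = (\<chi> i. det (\<chi> j. if j = k then axis i 1 else g j)) \<bullet> x"
proof -
  have "det (\<chi> j. if j = k then x else g j)
      = det (\<chi> j. if j = k then \<Sum>i\<in>UNIV. x $ i *s axis i 1 else g j)"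
    by (simp only: basis_expansion)
  also have "\<dots> = (\<Sum>i\<in>UNIV. x $ i * det (\<chi> j. if j = k then axis i 1 else g j))"
    by (simp only: det_linear_row_sum[OF finite] det_row_mul)
  finally show ?thesis by (simp add: inner_vec_def mult.commute)
qed

lemma AE_lborel_inner_nz:
  fixes a :: "'a::euclidean_space"
  assumes "a \<noteq> 0"
  shows "AE x in lborel. a \<bullet> x \<noteq> 0"
proof -
  have "{x. a \<bullet> x = 0} \<in> null_sets lebesgue"
    using negligible_hyperplane[of a 0] assms by (simp add: negligible_iff_null_sets)
  then have "AE x in lebesgue. a \<bullet> x \<noteq> 0"
    by (rule AE_I') auto
  then show ?thesis by (simp add: AE_completion_iff)
qed

text \<open>Given the other rows, a row makes the determinant vanish only if it lies in a hyperplane.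
  The rows are randomised one after the other, starting from the identity matrix.\<close>

lemma AE_PiM_det_nz:
  fixes D :: "'n \<Rightarrow> (real ^ 'n) measure"
  assumes prob: "\<And>j. prob_space (D j)" and sets: "\<And>j. sets (D j) = sets borel"
    and hyperplane: "\<And>j a. a \<noteq> 0 \<Longrightarrow> AE x in D j. a \<bullet> x \<noteq> 0"
  shows "AE f in PiM K D. det (\<chi> j. if j \<in> K then f j else axis j 1) \<noteq> 0"
  using finite[of K]
proof (induction K rule: finite_induct)
  case empty
  have "(\<chi> j. axis j 1) = (mat 1 :: real ^ 'n ^ 'n)"
    by (auto simp: vec_eq_iff axis_def mat_def)
  then show ?case by simp
next
  case (insert k K)
  define g where "g f j = (if j \<in> K then f j else axis j 1)" for f :: "'n \<Rightarrow> real ^ 'n" and j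
  interpret P: prob_space "PiM K D" by (intro prob_space_PiM prob)
  interpret Dk: prob_space "D k" by (rule prob)
  interpret pair_sigma_finite "D k" "PiM K D" ..
  have comp [measurable]: "(\<lambda>f. f j $ i) \<in> borel_measurable (PiM J D)" if "j \<in> J" for i j J
  proof -
    have "(\<lambda>f. f j) \<in> measurable (PiM J D) borel"
      using measurable_component_singleton[OF that, of D] sets
      by (simp cong: measurable_cong_sets)
    then show ?thesis
      by (rule measurable_compose) (intro borel_measurable_continuous_onI continuous_intros)
  qed
  have fst_meas: "(\<lambda>z. fst z $ i) \<in> borel_measurable (D k \<Otimes>\<^sub>M PiM K D)" for i
  proof -
    have "fst \<in> measurable (D k \<Otimes>\<^sub>M PiM K D) borel"
      using measurable_fst[of "D k" "PiM K D"] sets by (simp cong: measurable_cong_sets)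
    then show ?thesis
      by (rule measurable_compose) (intro borel_measurable_continuous_onI continuous_intros)
  qed
  have g_meas: "(\<lambda>z. g (snd z) j $ i) \<in> borel_measurable (D k \<Otimes>\<^sub>M PiM K D)" for i j
    using measurable_compose[OF measurable_snd comp[of j K i]]
    by (cases "j \<in> K") (auto simp: g_def)
  have pair_meas: "(\<lambda>z. det (\<chi> j. if j = k then fst z else g (snd z) j))
      \<in> borel_measurable (D k \<Otimes>\<^sub>M PiM K D)"
    proof (rule borel_measurable_det)
    show "(\<lambda>z. (\<chi> j. if j = k then fst z else g (snd z) j) $ j $ i)
        \<in> borel_measurable (D k \<Otimes>\<^sub>M PiM K D)" for j i
      using fst_meas g_meas by (cases "j = k") auto
  qed
  have "AE f in PiM K D. AE x in D k. det (\<chi> j. if j = k then x else g f j) \<noteq> 0"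
    using insert.IH
  proof eventually_elim
    case (elim f)
    define a where "a = (\<chi> i. det (\<chi> j. if j = k then axis i 1 else g f j))"
    \<comment> \<open>Coordinate \<open>k\<close> of \<open>a\<close> is the determinant with the
      unit vector still in row \<open>k\<close>, which is nonzero by the induction
      hypothesis.\<close>
    have "(\<chi> j. if j = k then axis k 1 else g f j) = (\<chi> j. if j \<in> K then f j else axis j 1)"
      using insert.hyps by (auto simp: g_def vec_eq_iff)
    then have "a $ k \<noteq> 0" using elim by (simp add: a_def)
    then have "a \<noteq> 0" by auto
    moreover have "det (\<chi> j. if j = k then x else g f j) = a \<bullet> x" for x
      unfolding a_def by (rule det_row_eq_inner)
    ultimately show ?case using hyperplane by simp
  qed
  \<comment> \<open>Fubini exchanges the quantifiers, because the product measure below has the new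
    row as its first component.\<close>
  then have "AE x in D k. AE f in PiM K D. det (\<chi> j. if j = k then x else g f j) \<noteq> 0"
    using pair_meas by (subst AE_commute) auto
  then have "AE z in D k \<Otimes>\<^sub>M PiM K D. det (\<chi> j. if j = k then fst z else g (snd z) j) \<noteq> 0"
    using pair_meas by (subst (asm) AE_pair_iff) auto
  moreover have "(\<chi> j. if j = k then fst z else g (snd z) j)
      = (\<chi> j. if j \<in> insert k K then ((snd z)(k := fst z)) j else axis j 1)" for z :: "(real ^ 'n) \<times> ('n \<Rightarrow> real ^ 'n)"
    by (auto simp: g_def vec_eq_iff)
  ultimately have *: "AE z in D k \<Otimes>\<^sub>M PiM K D.
      det (\<chi> j. if j \<in> insert k K then ((snd z)(k := fst z)) j else axis j 1) \<noteq> 0"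
    by simp
  have meas: "(\<lambda>f. det (\<chi> j. if j \<in> insert k K then f j else axis j 1))
      \<in> borel_measurable (PiM (insert k K) D)"
  proof (rule borel_measurable_det)
    fix j i
    show "(\<lambda>f. (\<chi> j. if j \<in> insert k K then f j else axis j 1) $ j $ i)
        \<in> borel_measurable (PiM (insert k K) D)"
      using comp[of j "insert k K" i] by (cases "j \<in> insert k K") auto
  qed
  have "AE f in distr (D k \<Otimes>\<^sub>M PiM K D) (PiM (insert k K) D) (\<lambda>(x, f). f(k := x)).
      det (\<chi> j. if j \<in> insert k K then f j else axis j 1) \<noteq> 0"
    using * meas unfolding case_prod_beta' by (subst AE_distr_iff) auto
  then show ?case
    by (subst (asm) distr_pair_PiM_eq_PiM) (auto intro: prob)
qed

text \<open>Transfers independence from sample indices to matrix rows: \<open>B\<close> carries the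
  events to the image of \<open>J\<close> along the inverse of \<open>\<sigma>\<close>.\<close>

lemma (in prob_space) indep_vars_reindex:
  assumes indep: "indep_vars M' X (\<sigma> ` K)" and inj: "inj_on \<sigma> K"
  shows "indep_vars (\<lambda>j. M' (\<sigma> j)) (\<lambda>j. X (\<sigma> j)) K"
proof -
  define F where "F i = {X i -` A \<inter> space M | A. A \<in> sets (M' i)}" for i
  have F: "indep_sets F (\<sigma> ` K)" using indep by (simp add: indep_vars_def2 F_def[abs_def])
  have "indep_sets (\<lambda>j. F (\<sigma> j)) K"
  proof (rule indep_setsI)
    show "F (\<sigma> j) \<subseteq> events" if "j \<in> K" for j
      using F that by (auto simp: indep_sets_def)
    fix A J assume J: "J \<noteq> {}" "J \<subseteq> K" "finite J" and A: "\<forall>j\<in>J. A j \<in> F (\<sigma> j)"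
    have injJ: "inj_on \<sigma> J" using inj J(2) by (rule inj_on_subset)
    define B where "B i = A (inv_into J \<sigma> i)" for i
    have B: "B (\<sigma> j) = A j" if "j \<in> J" for j using that injJ by (simp add: B_def)
    have "prob (\<Inter>i\<in>\<sigma> ` J. B i) = (\<Prod>i\<in>\<sigma> ` J. prob (B i))"
      using J A B by (intro indep_setsD[OF F]) auto
    then show "prob (\<Inter>j\<in>J. A j) = (\<Prod>j\<in>J. prob (A j))"
      using B by (simp add: prod.reindex[OF injJ])
  qed
  then show ?thesis using indep by (simp add: indep_vars_def2 F_def[abs_def])
qed

text \<open>Independence makes the joint law of the rows a product measure, so
  \<open>AE_PiM_det_nz\<close> applies with all rows random.\<close>

lemma (in prob_space) AE_indep_rows_det_nz:
  fixes Y :: "'i \<Rightarrow> 'a \<Rightarrow> real ^ 'n" and \<sigma> :: "'n \<Rightarrow> 'i"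
  assumes indep: "indep_vars (\<lambda>_. borel) Y I" and \<sigma>: "inj \<sigma>" "range \<sigma> \<subseteq> I"
    and hyperplane: "\<And>i a. i \<in> I \<Longrightarrow> a \<noteq> 0 \<Longrightarrow> AE \<omega> in M. a \<bullet> Y i \<omega> \<noteq> 0"
  shows "AE \<omega> in M. det (\<chi> j. Y (\<sigma> j) \<omega>) \<noteq> 0"
proof -
  have rv [measurable]: "random_variable borel (Y i)" if "i \<in> I" for i
    using indep that by (simp add: indep_vars_def)
  have rv\<sigma> [measurable]: "random_variable borel (Y (\<sigma> j))" for j
    using \<sigma>(2) by (intro rv) auto
  have "indep_vars (\<lambda>_. borel) Y (range \<sigma>)" using indep \<sigma>(2) by (rule indep_vars_subset)
  then have "indep_vars (\<lambda>_. borel) (\<lambda>j. Y (\<sigma> j)) UNIV"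
    using \<sigma>(1) by (rule indep_vars_reindex)
  then have distr: "distr M (\<Pi>\<^sub>M j\<in>UNIV. borel) (\<lambda>\<omega>. \<lambda>j\<in>UNIV. Y (\<sigma> j) \<omega>)
      = (\<Pi>\<^sub>M j\<in>UNIV. distr M borel (Y (\<sigma> j)))"
    using indep_vars_iff_distr_eq_PiM'[of UNIV "\<lambda>j. Y (\<sigma> j)" "\<lambda>_. borel"] rv\<sigma> by simp
  have "AE f in (\<Pi>\<^sub>M j\<in>UNIV. distr M borel (Y (\<sigma> j))).
      det (\<chi> j. if j \<in> UNIV then f j else axis j 1) \<noteq> 0"
  proof (rule AE_PiM_det_nz)
    show "prob_space (distr M borel (Y (\<sigma> j)))" for j by (intro prob_space_distr rv\<sigma>)
    show "AE x in distr M borel (Y (\<sigma> j)). a \<bullet> x \<noteq> 0" if "a \<noteq> 0" for j a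
      using hyperplane[OF _ that, of "\<sigma> j"] \<sigma>(2) by (subst AE_distr_iff) auto
  qed simp
  then have "AE f in distr M (\<Pi>\<^sub>M j\<in>UNIV. borel) (\<lambda>\<omega>. \<lambda>j\<in>UNIV. Y (\<sigma> j) \<omega>). det (\<chi> j. f j) \<noteq> 0"
    unfolding distr by simp
  then have "AE \<omega> in M. det (\<chi> j. (\<lambda>j\<in>UNIV. Y (\<sigma> j) \<omega>) j) \<noteq> 0"
    by (rule AE_distrD[rotated]) (intro measurable_restrict rv\<sigma>)
  then show ?thesis by simp
qed

text \<open>Absolute continuity: the hyperplane orthogonal to \<open>a\<close> is Lebesgue null,
  hence null for the law of \<open>X\<close>.\<close>

lemma AE_distributed_inner_nz:
  fixes X :: "'a \<Rightarrow> 'b::euclidean_space"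
  assumes "distributed M lborel X f" "a \<noteq> 0"
  shows "AE \<omega> in M. a \<bullet> X \<omega> \<noteq> 0"
proof -
  have f: "f \<in> borel_measurable lborel" and X: "X \<in> measurable M lborel"
    and distr: "distr M lborel X = density lborel f"
    using assms(1) by (auto simp: distributed_def)
  have "AE x in distr M lborel X. a \<bullet> x \<noteq> 0"
    unfolding distr using AE_lborel_inner_nz[OF assms(2)] f by (auto simp: AE_density)
  then show ?thesis by (rule AE_distrD[OF X])
qed

section \<open>Existence and non-existence of maximisers\<close>

lemma det_sq_mult_det_le:
  fixes P :: "real ^ 'n ^ 'n" and z :: "'n \<Rightarrow> real ^ 'n"
  assumes "psd_matrix P"
  shows "(det (\<chi> j. z j))\<^sup>2 * det P \<le> fact CARD('n) * (\<Prod>j\<in>UNIV. z j \<bullet> (P *v z j))"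
proof -
  define B where "B = (\<chi> j. z j)"
  \<comment> \<open>The congruent matrix has the values of the form at the \<open>z j\<close> on its
    diagonal, so \<open>psd_det_le\<close> applies to it.\<close>
  have "(det B)\<^sup>2 * det P = det (B ** P ** transpose B)"
    by (simp add: det_mul power2_eq_square)
  also have "\<dots> \<le> fact CARD('n) * (\<Prod>j\<in>UNIV. z j \<bullet> (P *v z j))"
    using psd_det_le[OF psd_congruence[OF assms], of B] by (simp add: nth_congruence B_def)
  finally show ?thesis by (simp add: B_def)
qed

text \<open>With \<open>e\<close> numbering the coordinates from 0, window \<open>k\<close> is a run
  of consecutive points on a circle of \<open>N\<close> points, starting at \<open>k\<close>;
  \<open>Suc\<close> is there because the sample is indexed from 1.\<close>

definition cyclic_window :: "nat \<Rightarrow> ('n::finite \<Rightarrow> nat) \<Rightarrow> nat \<Rightarrow> 'n \<Rightarrow> nat" where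
  "cyclic_window N e k j = Suc ((k + e j) mod N)"

lemma inj_on_mod_shift:
  fixes N a :: nat
  assumes "a < N"
  shows "inj_on (\<lambda>k. Suc ((k + a) mod N)) {..<N}"
proof (rule inj_onI)
  fix k l assume kl: "k \<in> {..<N}" "l \<in> {..<N}" "Suc ((k + a) mod N) = Suc ((l + a) mod N)"
  have "(m + a) mod N = (if m + a < N then m + a else m + a - N)" if "m < N" for m
    using that assms by (simp add: mod_if)
  then show "k = l" using kl assms by (simp split: if_splits)
qed

lemma bij_betw_mod_shift:
  fixes N a :: nat
  assumes "a < N"
  shows "bij_betw (\<lambda>k. Suc ((k + a) mod N)) {..<N} {1..N}"
proof -
  have "(\<lambda>k. Suc ((k + a) mod N)) ` {..<N} = {1..N}"
    using assms by (intro card_subset_eq) (auto simp: card_image[OF inj_on_mod_shift] Suc_le_eq)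
  then show ?thesis using inj_on_mod_shift[OF assms] by (simp add: bij_betw_def)
qed

text \<open>The shift lemma with exchanged roles: here \<open>k\<close> is the fixed shift and
  \<open>e j\<close> varies.\<close>

lemma cyclic_window_inj:
  assumes "inj e" "\<And>j. e j < N" "k < N"
  shows "inj (cyclic_window N e k)" "range (cyclic_window N e k) \<subseteq> {1..N}"
proof -
  show "inj (cyclic_window N e k)"
  proof (rule injI)
    fix i j assume "cyclic_window N e k i = cyclic_window N e k j"
    then have "e i = e j"
      using inj_onD[OF inj_on_mod_shift[OF assms(3)], of "e i" "e j"] assms(2)
      by (simp add: cyclic_window_def add.commute)
    then show "i = j" using assms(1) by (rule injD[rotated])
  qed
  show "range (cyclic_window N e k) \<subseteq> {1..N}"
    using assms(3) by (auto simp: cyclic_window_def Suc_le_eq)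
qed

text \<open>Multiplying the Hadamard bounds over all cyclic windows uses every sample point equally
  often.\<close>

lemma det_power_le:
  fixes y :: "nat \<Rightarrow> real ^ 'n" and e :: "'n \<Rightarrow> nat"
  assumes e: "\<And>j. e j < N"
    and basis: "\<And>k. k < N \<Longrightarrow> det (\<chi> j. y (cyclic_window N e k j)) \<noteq> 0"
  obtains c where "0 < c"
    "\<And>P. psd_matrix P \<Longrightarrow> 0 \<le> det P \<Longrightarrow> det P ^ N \<le> c * (\<Prod>i=1..N. y i \<bullet> (P *v y i)) ^ CARD('n)"
proof -
  define d where "d = (\<Prod>k<N. (det (\<chi> j. y (cyclic_window N e k j)))\<^sup>2)"
  have d: "0 < d" unfolding d_def using basis by (intro prod_pos) simp
  show ?thesis
  proof
    show "0 < fact CARD('n) ^ N / d" using d by simp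
    fix P :: "real ^ 'n ^ 'n" assume P: "psd_matrix P" "0 \<le> det P"
    define q where "q i = y i \<bullet> (P *v y i)" for i
    have "d * det P ^ N = (\<Prod>k<N. (det (\<chi> j. y (cyclic_window N e k j)))\<^sup>2 * det P)"
      by (simp add: d_def prod.distrib)
    also have "\<dots> \<le> (\<Prod>k<N. fact CARD('n) * (\<Prod>j\<in>UNIV. q (cyclic_window N e k j)))"
      unfolding q_def using P by (intro prod_mono conjI det_sq_mult_det_le) auto
    also have "\<dots> = fact CARD('n) ^ N * (\<Prod>j\<in>UNIV. \<Prod>k<N. q (cyclic_window N e k j))"
      by (simp add: prod.distrib prod.swap[of _ UNIV])
    \<comment> \<open>For fixed \<open>j\<close> the window number \<open>k\<close> runs through
      every sample index once, so the product over \<open>k\<close> does not depend on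
      \<open>j\<close>.\<close>
    also have "(\<Prod>k<N. q (cyclic_window N e k j)) = (\<Prod>i=1..N. q i)" for j
      unfolding cyclic_window_def by (rule prod.reindex_bij_betw[OF bij_betw_mod_shift[OF e]])
    then have "(\<Prod>j\<in>UNIV. \<Prod>k<N. q (cyclic_window N e k j)) = (\<Prod>i=1..N. q i) ^ CARD('n)"
      by simp
    finally show "det P ^ N \<le> fact CARD('n) ^ N / d * (\<Prod>i=1..N. y i \<bullet> (P *v y i)) ^ CARD('n)"
      using d by (simp add: q_def field_simps)
  qed
qed

section \<open>The likelihood as a function of the precision matrix\<close>

definition SL_objective :: "nat \<Rightarrow> (nat \<Rightarrow> real ^ 'p) \<Rightarrow> real ^ 'p ^ 'p \<Rightarrow> real" where
  "SL_objective N y P = (\<Prod>i=1..N. sqrt (det P) * SL_radial (real CARD('p)) (y i \<bullet> (P *v y i)))"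

lemma SL_likelihood_eq:
  fixes S :: "real ^ 'p ^ 'p"
  assumes S: "spd_matrix S" and y: "\<And>i. i \<in> {1..N} \<Longrightarrow> y i \<noteq> 0"
  shows "SL_likelihood N y S = SL_objective N y (matrix_inv S)"
  unfolding SL_likelihood_def SL_objective_def
proof (rule prod.cong)
  fix i assume "i \<in> {1..N}"
  then have "0 < y i \<bullet> (matrix_inv S *v y i)"
    using y spd_matrix_inv(2)[OF S] by (simp add: spd_matrix_def)
  then show "SL_density S (y i) = sqrt (det (matrix_inv S))
      * SL_radial (real CARD('p)) (y i \<bullet> (matrix_inv S *v y i))"
    by (simp add: SL_density_eq spd_matrix_inv(4)[OF S] real_sqrt_divide)
qed simp

lemma SL_objective_pos:
  fixes P :: "real ^ 'p ^ 'p"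
  assumes "spd_matrix P" "\<And>i. i \<in> {1..N} \<Longrightarrow> y i \<noteq> 0"
  shows "0 < SL_objective N y P"
  unfolding SL_objective_def using assms
  by (intro prod_pos mult_pos_pos SL_radial_pos ballI)
     (auto simp: spd_det_pos spd_matrix_def)

text \<open>Inversion is an involution on the positive definite matrices, so maximising over
  \<open>S\<close> or over its inverse is the same problem.\<close>

lemma is_SL_mle_iff_objective:
  fixes S :: "real ^ 'p ^ 'p"
  assumes "spd_matrix S" "\<And>i. i \<in> {1..N} \<Longrightarrow> y i \<noteq> 0"
  shows "is_SL_mle N y S
    \<longleftrightarrow> (\<forall>P. spd_matrix P \<longrightarrow> SL_objective N y P \<le> SL_objective N y (matrix_inv S))"
proof -
  have lik: "SL_likelihood N y T = SL_objective N y (matrix_inv T)" if "spd_matrix T" for T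
    using that assms(2) by (rule SL_likelihood_eq)
  have inv: "SL_objective N y P = SL_likelihood N y (matrix_inv P)" if "spd_matrix P" for P
    using that by (simp add: lik spd_matrix_inv(2,3))
  show ?thesis
  proof
    assume "is_SL_mle N y S"
    then show "\<forall>P. spd_matrix P \<longrightarrow> SL_objective N y P \<le> SL_objective N y (matrix_inv S)"
      using inv spd_matrix_inv(2) lik[OF assms(1)] by (auto simp: is_SL_mle_def)
  next
    assume "\<forall>P. spd_matrix P \<longrightarrow> SL_objective N y P \<le> SL_objective N y (matrix_inv S)"
    then show "is_SL_mle N y S"
      using assms(1) spd_matrix_inv(2) unfolding is_SL_mle_def by (metis lik)
  qed
qed

lemma no_SL_mle:
  fixes y :: "nat \<Rightarrow> real ^ 'p"
  assumes N: "1 \<le> N" "N < CARD('p)" and y: "\<And>i. i \<in> {1..N} \<Longrightarrow> y i \<noteq> 0"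
  shows "\<not> is_SL_mle N y S"
proof
  assume mle: "is_SL_mle N y S"
  then have S: "spd_matrix S" by (simp add: is_SL_mle_def)
  define P where "P = matrix_inv S"
  have P: "spd_matrix P" unfolding P_def using S by (rule spd_matrix_inv)
  have "dim (y ` {1..N}) \<le> card (y ` {1..N})" by (rule dim_le_card') simp
  also have "\<dots> \<le> N" using card_image_le[of "{1..N}" y] by simp
  finally have "dim (y ` {1..N}) < DIM(real ^ 'p)" using N by simp
  then obtain v where "v \<noteq> 0" and "\<And>x. x \<in> span (y ` {1..N}) \<Longrightarrow> orthogonal v x"
    by (rule orthogonal_to_subspace_exists) blast
  then have v: "v \<bullet> y i = 0" if "i \<in> {1..N}" for i
    using that by (simp add: orthogonal_def span_base)
  obtain B :: "real ^ 'p ^ 'p" where B: "det B = 2" "\<And>x. v \<bullet> x = 0 \<Longrightarrow> B *v x = x"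
    using exists_matrix_stretching_orthogonal[OF \<open>v \<noteq> 0\<close>] by blast
  \<comment> \<open>\<open>B\<close> fixes every \<open>y i\<close>, so the form keeps its values
    there, while the determinant is multiplied by \<open>2^2\<close>.\<close>
  define Q where "Q = transpose B ** P ** B"
  have detQ: "det Q = 4 * det P" by (simp add: Q_def det_mul B(1))
  have "psd_matrix Q"
    using psd_congruence[OF spd_imp_psd[OF P], of "transpose B"] by (simp add: Q_def)
  then have Q: "spd_matrix Q" using spd_det_pos[OF P] by (simp add: psd_det_nz_imp_spd detQ)
  have quad: "y i \<bullet> (Q *v y i) = y i \<bullet> (P *v y i)" if "i \<in> {1..N}" for i
    using inner_congruence[of "y i" "transpose B" P "y i"] B(2)[OF v[OF that]]
    by (simp add: Q_def del: transpose_matrix_vector)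
  have less: "0 \<le> sqrt (det P) * SL_radial (real CARD('p)) (y i \<bullet> (P *v y i)) \<and>
      sqrt (det P) * SL_radial (real CARD('p)) (y i \<bullet> (P *v y i))
      < sqrt (det Q) * SL_radial (real CARD('p)) (y i \<bullet> (Q *v y i))" if i: "i \<in> {1..N}" for i
  proof -
    have "0 < y i \<bullet> (P *v y i)" using P y[OF i] by (simp add: spd_matrix_def)
    then have "0 < SL_radial (real CARD('p)) (y i \<bullet> (P *v y i))" by (rule SL_radial_pos) simp
    moreover have "0 < sqrt (det P)" "sqrt (det P) < sqrt (det Q)"
      using spd_det_pos[OF P] by (auto simp: detQ)
    ultimately show ?thesis unfolding quad[OF i] by simp
  qed
  \<comment> \<open>The product is strictly larger only if it has a factor at all.\<close>
  have "1 \<in> {1..N}" using N by simp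
  then have "SL_objective N y P < SL_objective N y Q"
    unfolding SL_objective_def using less by (intro prod_mono_strict[of 1]) fastforce+
  then show False
    using mle Q is_SL_mle_iff_objective[OF S y, of N] unfolding P_def by (meson not_less)
qed

section \<open>Compactness of superlevel sets\<close>

lemma continuous_on_quadratic_form [continuous_intros]:
  fixes x :: "real ^ 'n"
  shows "continuous_on A (\<lambda>P. x \<bullet> (P *v x))"
  unfolding inner_vec_def matrix_vector_mult_def by (simp, intro continuous_intros)

lemma closed_psd_matrix: "closed {P :: real ^ 'n ^ 'n. psd_matrix P}"
proof -
  have "closed {P :: real ^ 'n ^ 'n. (\<forall>i j. P $ j $ i = P $ i $ j) \<and> (\<forall>x. 0 \<le> x \<bullet> (P *v x))}"
    by (intro closed_Collect_conj closed_Collect_all closed_Collect_eq closed_Collect_le continuous_intros)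
  then show ?thesis by (simp add: psd_matrix_def transpose_def vec_eq_iff)
qed

text \<open>In the basis \<open>z\<close> the diagonal is at most \<open>b\<close>, hence so is
  every entry in absolute value by \<open>psd_nth_le\<close>; the change back with the inverse
  \<open>A\<close> of \<open>B\<close> is linear and preserves boundedness.\<close>

lemma bounded_psd_matrices:
  fixes z :: "'n \<Rightarrow> real ^ 'n"
  assumes basis: "det (\<chi> j. z j) \<noteq> 0"
  shows "bounded {P. psd_matrix P \<and> (\<forall>j. z j \<bullet> (P *v z j) \<le> b)}" (is "bounded ?K")
proof -
  define B where "B = (\<chi> j. z j)"
  obtain A where A: "A ** B = mat 1" "B ** A = mat 1"
    using basis unfolding B_def by (metis invertible_def invertible_det_nz)
  define h where "h Z = A ** Z ** transpose A" for Z :: "real ^ 'n ^ 'n"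
  have "linear h"
  proof (rule linearI)
    have "(X + X') ** C = X ** C + X' ** C" for X X' C :: "real ^ 'n ^ 'n"
      by (simp add: matrix_matrix_mult_def vec_eq_iff distrib_right sum.distrib)
    then show "h (Z + W) = h Z + h W" for Z W
      by (simp add: h_def matrix_add_ldistrib)
    show "h (r *\<^sub>R Z) = r *\<^sub>R h Z" for r Z
      by (simp only: h_def matrix_scalar_ac scalar_matrix_assoc)
  qed
  have "bounded {Z :: real ^ 'n ^ 'n. \<forall>i j. \<bar>Z $ i $ j\<bar> \<le> b}"
  proof (rule boundedI)
    fix Z :: "real ^ 'n ^ 'n" assume "Z \<in> {Z. \<forall>i j. \<bar>Z $ i $ j\<bar> \<le> b}"
    then have Z: "\<bar>Z $ i $ j\<bar> \<le> b" for i j by simp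
    have "norm Z \<le> (\<Sum>i\<in>UNIV. norm (Z $ i))"
      unfolding norm_vec_def by (rule L2_set_le_sum) simp
    also have "\<dots> \<le> (\<Sum>i\<in>(UNIV :: 'n set). \<Sum>j\<in>(UNIV :: 'n set). b)"
      by (intro sum_mono order_trans[OF norm_le_l1_cart] Z)
    finally show "norm Z \<le> (\<Sum>i\<in>(UNIV :: 'n set). \<Sum>j\<in>(UNIV :: 'n set). b)" .
  qed
  then have "bounded (h ` {Z. \<forall>i j. \<bar>Z $ i $ j\<bar> \<le> b})"
    by (rule bounded_linear_image) (rule linear_conv_bounded_linear[THEN iffD1, OF \<open>linear h\<close>])
  moreover have "?K \<subseteq> h ` {Z. \<forall>i j. \<bar>Z $ i $ j\<bar> \<le> b}"
  proof
    fix P assume "P \<in> ?K"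
    then have P: "psd_matrix P" and b: "\<And>j. z j \<bullet> (P *v z j) \<le> b" by auto
    define Z where "Z = B ** P ** transpose B"
    have "psd_matrix Z" unfolding Z_def using P by (rule psd_congruence)
    have diag: "Z $ j $ j \<le> b" for j using b by (simp add: Z_def nth_congruence B_def)
    have "0 \<le> b" using psd_nth_le(2)[OF \<open>psd_matrix Z\<close>] diag by (rule order_trans)
    have "\<bar>Z $ i $ j\<bar> \<le> b" for i j
    proof -
      have "\<bar>Z $ i $ j\<bar> \<le> sqrt (Z $ i $ i) * sqrt (Z $ j $ j)"
        using \<open>psd_matrix Z\<close> by (rule psd_nth_le)
      also have "\<dots> \<le> sqrt b * sqrt b"
        using \<open>0 \<le> b\<close> psd_nth_le(2)[OF \<open>psd_matrix Z\<close>]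
        by (intro mult_mono real_sqrt_le_mono diag real_sqrt_ge_zero) auto
      also have "\<dots> = b"
        using \<open>0 \<le> b\<close> by simp
      finally show ?thesis .
    qed
    moreover have "h Z = P"
    proof -
      have "transpose B ** transpose A = mat 1" by (simp only: matrix_transpose_mul[symmetric] A transpose_mat)
      moreover have "h Z = (A ** B) ** P ** (transpose B ** transpose A)"
        by (simp only: h_def Z_def matrix_mul_assoc)
      ultimately show ?thesis using A by simp
    qed
    ultimately show "P \<in> h ` {Z. \<forall>i j. \<bar>Z $ i $ j\<bar> \<le> b}" by blast
  qed
  ultimately show ?thesis by (rule bounded_subset)
qed

lemma sqrt_prod: "sqrt (prod f A) = (\<Prod>i\<in>A. sqrt (f i))"
  by (induction A rule: infinite_finite_induct) (auto simp: real_sqrt_mult)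

text \<open>The square root of \<open>det_power_le\<close> replaces \<open>sqrt (det P) ^ N\<close>
  by powers of the \<open>sqrt q\<^sub>i\<close>, so that the bound splits into one factor per
  sample point.\<close>

lemma SL_objective_le:
  fixes y :: "nat \<Rightarrow> real ^ 'p" and e :: "'p \<Rightarrow> nat"
  assumes e: "\<And>j. e j < N" and y: "\<And>i. i \<in> {1..N} \<Longrightarrow> y i \<noteq> 0"
    and basis: "\<And>k. k < N \<Longrightarrow> det (\<chi> j. y (cyclic_window N e k j)) \<noteq> 0"
  obtains c where "0 < c" "\<And>P. spd_matrix P \<Longrightarrow> SL_objective N y P
    \<le> c * (\<Prod>i=1..N. sqrt (y i \<bullet> (P *v y i)) powr real CARD('p)
               * SL_radial (real CARD('p)) (y i \<bullet> (P *v y i)))"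
proof -
  obtain c where c: "0 < c" "\<And>P. psd_matrix P \<Longrightarrow> 0 \<le> det P \<Longrightarrow>
      det P ^ N \<le> c * (\<Prod>i=1..N. y i \<bullet> (P *v y i)) ^ CARD('p)"
    using det_power_le[OF e basis] by blast
  show ?thesis
  proof
    show "0 < sqrt c" using c by simp
    fix P :: "real ^ 'p ^ 'p" assume P: "spd_matrix P"
    define q where "q i = y i \<bullet> (P *v y i)" for i
    define R where "R = (\<Prod>i=1..N. SL_radial (real CARD('p)) (q i))"
    have q: "0 < q i" if "i \<in> {1..N}" for i
      using P y[OF that] by (simp add: q_def spd_matrix_def)
    have R: "0 \<le> R" unfolding R_def using q by (intro prod_nonneg) (simp add: SL_radial_pos less_imp_le)
    have "sqrt (det P) ^ N = sqrt (det P ^ N)" by (simp add: real_sqrt_power)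
    also have "\<dots> \<le> sqrt (c * (\<Prod>i=1..N. q i) ^ CARD('p))"
      unfolding q_def using c(2)[OF spd_imp_psd[OF P]] spd_det_pos[OF P] by simp
    also have "\<dots> = sqrt c * (\<Prod>i=1..N. sqrt (q i)) ^ CARD('p)"
      by (simp add: real_sqrt_mult real_sqrt_power sqrt_prod)
    also have "\<dots> = sqrt c * (\<Prod>i=1..N. sqrt (q i) powr real CARD('p))"
      unfolding prod_power_distrib using q by (simp add: powr_realpow)
    finally have "sqrt (det P) ^ N * R \<le> sqrt c * (\<Prod>i=1..N. sqrt (q i) powr real CARD('p)) * R"
      using R by (rule mult_right_mono)
    then show "SL_objective N y P \<le> sqrt c * (\<Prod>i=1..N. sqrt (y i \<bullet> (P *v y i)) powr real CARD('p)
               * SL_radial (real CARD('p)) (y i \<bullet> (P *v y i)))"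
      by (simp add: SL_objective_def R_def q_def prod.distrib mult.assoc)
  qed
qed

text \<open>All factors \<open>w q\<^sub>i\<close> are at most \<open>C\<close>, so a lower bound on
  their product bounds each of them below; the two power estimates then enclose
  \<open>q\<^sub>i\<close>.\<close>

lemma SL_objective_superlevel:
  fixes y :: "nat \<Rightarrow> real ^ 'p" and e :: "'p \<Rightarrow> nat"
  assumes e: "\<And>j. e j < N" and y: "\<And>i. i \<in> {1..N} \<Longrightarrow> y i \<noteq> 0"
    and basis: "\<And>k. k < N \<Longrightarrow> det (\<chi> j. y (cyclic_window N e k j)) \<noteq> 0"
    and \<eta>: "0 < \<eta>"
  obtains a b where "0 < a" "\<And>P i. spd_matrix P \<Longrightarrow> \<eta> \<le> SL_objective N y P \<Longrightarrow> i \<in> {1..N}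
    \<Longrightarrow> a \<le> y i \<bullet> (P *v y i) \<and> y i \<bullet> (P *v y i) \<le> b"
proof -
  define p where "p = real CARD('p)"
  have p: "1 \<le> p" unfolding p_def by (simp add: Suc_le_eq)
  define w where "w q = sqrt q powr p * SL_radial p q" for q
  have w_pos: "0 < w q" if "0 < q" for q
    using that p by (simp add: w_def SL_radial_pos)
  obtain C where C: "\<And>q. 0 < q \<Longrightarrow> w q \<le> C * q powr (1 / 4)"
      "\<And>q. 0 < q \<Longrightarrow> w q \<le> C * q powr (- (1 / 4))"
    using SL_radial_weighted_le[OF p] unfolding w_def by blast
  have C_pos: "0 < C" using w_pos[of 1] C(1)[of 1] by simp
  have w_le: "w q \<le> C" if "0 < q" for q
  proof (cases "q \<le> 1")
    case True
    then have "q powr (1 / 4) \<le> 1" using that by (simp add: powr_le1)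
    then show ?thesis using C(1)[OF that] C_pos mult_left_le[of "q powr (1 / 4)" C] by linarith
  next
    case False
    then have "q powr (- (1 / 4)) \<le> 1" using powr_mono[of "- (1 / 4)" 0 q] by simp
    then show ?thesis using C(2)[OF that] C_pos mult_left_le[of "q powr (- (1 / 4))" C] by linarith
  qed
  obtain c where c: "0 < c" "\<And>P. spd_matrix P \<Longrightarrow> SL_objective N y P
      \<le> c * (\<Prod>i=1..N. w (y i \<bullet> (P *v y i)))"
    using SL_objective_le[OF e y basis] unfolding w_def p_def by blast
  \<comment> \<open>The other \<open>N - 1\<close> factors contribute at most
    \<open>C ^ (N - 1)\<close>.\<close>
  define \<delta> where "\<delta> = \<eta> / (c * C ^ (N - 1))"
  have \<delta>: "0 < \<delta>" using \<eta> c(1) C_pos by (simp add: \<delta>_def)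
  show ?thesis
  proof
    show "0 < (\<delta> / C) powr 4" using \<delta> C_pos by simp
    fix P :: "real ^ 'p ^ 'p" and i
    assume P: "spd_matrix P" and le: "\<eta> \<le> SL_objective N y P" and i: "i \<in> {1..N}"
    define q where "q k = y k \<bullet> (P *v y k)" for k
    have q: "0 < q k" if "k \<in> {1..N}" for k
      using P y[OF that] by (simp add: q_def spd_matrix_def)
    have "\<eta> \<le> c * (\<Prod>k=1..N. w (q k))" using le c(2)[OF P] by (simp add: q_def)
    also have "(\<Prod>k=1..N. w (q k)) = w (q i) * (\<Prod>k\<in>{1..N} - {i}. w (q k))"
      using i by (simp add: prod.remove)
    also have "(\<Prod>k\<in>{1..N} - {i}. w (q k)) \<le> (\<Prod>k\<in>{1..N} - {i}. C)"
      using w_le w_pos q by (intro prod_mono) (auto simp: less_imp_le)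
    also have "\<dots> = C ^ (N - 1)" using i by simp
    finally have "\<eta> \<le> c * (w (q i) * C ^ (N - 1))"
      using c(1) w_pos[OF q[OF i]] by (simp add: mult_left_mono)
    then have w: "\<delta> \<le> w (q i)" using c(1) C_pos by (simp add: \<delta>_def field_simps)
    have "\<delta> / C \<le> q i powr (1 / 4)"
      using order_trans[OF w C(1)[OF q[OF i]]] C_pos by (simp add: field_simps)
    then have "(\<delta> / C) powr 4 \<le> (q i powr (1 / 4)) powr 4"
      using \<delta> C_pos by (intro powr_mono2) auto
    then have lower: "(\<delta> / C) powr 4 \<le> q i" using q[OF i] by (simp add: powr_powr)
    \<comment> \<open>The negative exponent turns the lower bound on \<open>w (q i)\<close> into an
      upper bound on \<open>q i\<close>.\<close>
    have "\<delta> / C \<le> q i powr (- (1 / 4))"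
      using order_trans[OF w C(2)[OF q[OF i]]] C_pos by (simp add: field_simps)
    then have "(q i powr (- (1 / 4))) powr (- 4) \<le> (\<delta> / C) powr (- 4)"
      using \<delta> C_pos by (intro powr_mono2') auto
    then have "q i \<le> (\<delta> / C) powr (- 4)" using q[OF i] by (simp add: powr_powr)
    with lower show "(\<delta> / C) powr 4 \<le> y i \<bullet> (P *v y i) \<and> y i \<bullet> (P *v y i) \<le> (\<delta> / C) powr (- 4)"
      by (simp add: q_def)
  qed
qed

lemma spd_mat_1: "spd_matrix (mat 1 :: real ^ 'n ^ 'n)"
  by (simp add: spd_matrix_def)

lemma exists_SL_mle:
  fixes y :: "nat \<Rightarrow> real ^ 'p" and e :: "'p \<Rightarrow> nat"
  assumes e: "inj e" "\<And>j. e j < N" and y: "\<And>i. i \<in> {1..N} \<Longrightarrow> y i \<noteq> 0"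
    and basis: "\<And>k. k < N \<Longrightarrow> det (\<chi> j. y (cyclic_window N e k j)) \<noteq> 0"
  shows "\<exists>S. is_SL_mle N y S"
proof -
  have N: "0 < N" using e(2)[of undefined] by simp
  \<comment> \<open>The identity serves as reference point, which makes the superlevel set
    nonempty.\<close>
  define \<eta> where "\<eta> = SL_objective N y (mat 1)"
  have \<eta>: "0 < \<eta>" unfolding \<eta>_def using spd_mat_1 y by (rule SL_objective_pos)
  obtain a b where a: "0 < a" and ab: "\<And>P i. spd_matrix P \<Longrightarrow> \<eta> \<le> SL_objective N y P \<Longrightarrow> i \<in> {1..N}
      \<Longrightarrow> a \<le> y i \<bullet> (P *v y i) \<and> y i \<bullet> (P *v y i) \<le> b"
    using SL_objective_superlevel[OF e(2) y basis \<eta>] by blast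
  \<comment> \<open>The bound \<open>a\<close> keeps the arguments of \<open>SL_radial\<close> in
    \<open>{a..}\<close>, where its continuity is known.\<close>
  define K where "K = {P. psd_matrix P \<and> (\<forall>i\<in>{1..N}. a \<le> y i \<bullet> (P *v y i) \<and> y i \<bullet> (P *v y i) \<le> b)}"
  have in_K: "P \<in> K" if "spd_matrix P" "\<eta> \<le> SL_objective N y P" for P
    using that ab spd_imp_psd by (auto simp: K_def)
  have "closed K"
    unfolding K_def Ball_def
    by (intro closed_Collect_conj closed_psd_matrix closed_Collect_all closed_Collect_imp
        closed_Collect_le continuous_intros) auto
  \<comment> \<open>Window 0 alone supplies a basis, which suffices for boundedness.\<close>
  moreover have "K \<subseteq> {P. psd_matrix P \<and>
      (\<forall>j. y (cyclic_window N e 0 j) \<bullet> (P *v y (cyclic_window N e 0 j)) \<le> b)}"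
    using cyclic_window_inj(2)[OF e N] by (auto simp: K_def)
  then have "bounded K"
    using bounded_psd_matrices[OF basis[OF N]] bounded_subset by blast
  ultimately have "compact K" by (simp add: compact_eq_bounded_closed)
  moreover have "continuous_on K (SL_objective N y)"
    unfolding SL_objective_def
  proof (intro continuous_intros)
    fix i assume i: "i \<in> {1..N}"
    show "continuous_on K (\<lambda>P. SL_radial (real CARD('p)) (y i \<bullet> (P *v y i)))"
      by (rule continuous_on_compose2[OF continuous_on_SL_radial[OF a]])
         (use i in \<open>auto simp: K_def intro!: continuous_intros\<close>)
  qed
  moreover have "mat 1 \<in> K" using spd_mat_1 by (rule in_K) (simp add: \<eta>_def)
  ultimately obtain P where P: "P \<in> K" and max: "\<And>Q. Q \<in> K \<Longrightarrow> SL_objective N y Q \<le> SL_objective N y P"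
    using continuous_attains_sup[of K "SL_objective N y"] by blast
  have ge: "\<eta> \<le> SL_objective N y P" using max[OF \<open>mat 1 \<in> K\<close>] by (simp add: \<eta>_def)
  \<comment> \<open>At a singular matrix the objective is 0, below the reference value
    \<open>\<eta>\<close>.\<close>
  have "det P \<noteq> 0"
  proof
    assume "det P = 0"
    then have "SL_objective N y P = 0" using N by (simp add: SL_objective_def)
    then show False using ge \<eta> by simp
  qed
  then have spd: "spd_matrix P" using P by (simp add: K_def psd_det_nz_imp_spd)
  have "SL_objective N y Q \<le> SL_objective N y P" if "spd_matrix Q" for Q
    using max in_K[OF that] ge by fastforce
  then have "is_SL_mle N y (matrix_inv P)"
    using is_SL_mle_iff_objective[OF spd_matrix_inv(2)[OF spd] y] spd_matrix_inv(3)[OF spd] by simp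
  then show ?thesis ..
qed

theorem theorem4p1:
  fixes M :: "'a measure"
    and Y :: "nat \<Rightarrow> 'a \<Rightarrow> real ^ 'p"
    and \<Sigma> :: "real ^ 'p ^ 'p"
    and N :: nat
  assumes "prob_space M"
    and "N \<ge> 1"
    and "spd_matrix \<Sigma>"
    and "prob_space.indep_vars M (\<lambda>_. borel) Y {1..N}"
    and "\<And>i. i \<in> {1..N} \<Longrightarrow> distributed M lborel (Y i) (\<lambda>y. ennreal (SL_density \<Sigma> y))"
  shows "(AE \<omega> in M. \<exists>S. is_SL_mle N (\<lambda>i. Y i \<omega>) S) \<longleftrightarrow> N \<ge> CARD('p)"
proof -
  interpret prob_space M by fact
  have hyperplane: "AE \<omega> in M. a \<bullet> Y i \<omega> \<noteq> 0" if "i \<in> {1..N}" "a \<noteq> 0" for i a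
    using AE_distributed_inner_nz[OF assms(5)[OF that(1)] that(2)] .
  \<comment> \<open>The origin lies in any hyperplane through it, so a single one is enough.\<close>
  have "AE \<omega> in M. Y i \<omega> \<noteq> 0" if "i \<in> {1..N}" for i
    using hyperplane[OF that, of "axis undefined 1"] by (auto simp: axis_eq_0_iff elim: eventually_mono)
  then have nz: "AE \<omega> in M. \<forall>i\<in>{1..N}. Y i \<omega> \<noteq> 0" by (intro AE_finite_allI) auto
  show ?thesis
  proof
    assume mle: "AE \<omega> in M. \<exists>S. is_SL_mle N (\<lambda>i. Y i \<omega>) S"
    show "N \<ge> CARD('p)"
    proof (rule ccontr)
      assume "\<not> N \<ge> CARD('p)"
      then have N: "N < CARD('p)" by simp
      have "AE \<omega> in M. False"
        using mle nz by eventually_elim (use no_SL_mle[OF assms(2) N] in force)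
      then show False by simp
    qed
  next
    assume "N \<ge> CARD('p)"
    obtain e :: "'p \<Rightarrow> nat" where e: "bij_betw e UNIV {0..<CARD('p)}"
      using ex_bij_betw_finite_nat[OF finite] by blast
    have inj: "inj e" using e by (simp add: bij_betw_def)
    have less: "e j < N" for j using bij_betwE[OF e] \<open>N \<ge> CARD('p)\<close>
      by (meson UNIV_I atLeastLessThan_iff order_less_le_trans)
    \<comment> \<open>There are finitely many windows, so the union of the exceptional sets is still
      null.\<close>
    have "AE \<omega> in M. \<forall>k\<in>{..<N}. det (\<chi> j. Y (cyclic_window N e k j) \<omega>) \<noteq> 0"
      using AE_indep_rows_det_nz[OF assms(4) cyclic_window_inj[OF inj less] hyperplane]
      by (intro AE_finite_allI) auto
    then show "AE \<omega> in M. \<exists>S. is_SL_mle N (\<lambda>i. Y i \<omega>) S"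
      using nz by eventually_elim (rule exists_SL_mle[OF inj less], auto)
  qed
qed

end
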